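(* Let $\alpha>0$. For every $(z,\sigma)\in\mathbb{R}^N=\mathbb{R}^m\times\mathbb{R}^k$, the anisotropic Legendre transformation $\Theta^0$ of the gauge $\Theta$, defined by the constrained extremum problem $$\Theta^0(z,\sigma)^{\alpha+1}=\sup_{\Theta(\xi,\tau)=1}\left(|\langle z,\xi\rangle|^{\alpha+1}+4(\alpha+1)^2\langle\sigma,\tau\rangle\right),$$ is given by $$\Theta^0(z,\sigma)=\left(\Phi^0(z)^{2(\alpha+1)}+4(\alpha+1)^2\Psi^0(\sigma)^2\right)^{\frac{1}{2(\alpha+1)}}.$$
   Context: A Minkowski norm on $\mathbb{R}^n$ is a function $N:\mathbb{R}^n\to[0,\infty)$ such that $N^2\in C^2(\mathbb{R}^n\setminus\{0\})$ is strictly convex and $N(\lambda x)=|\lambda|N(x)$ for all $x\in\mathbb{R}^n$, $\lambda\in\mathbb{R}$. Let $m,k\ge1$, $N=m+k$, and let $\Phi:\mathbb{R}^m\to[0,\infty)$ and $\Psi:\mathbb{R}^k\to[0,\infty)$ be Minkowski norms. Their standard Legendre transforms (dual norms) are $\Phi^0(z)=\sup_{\Phi(\zeta)=1}\langle z,\zeta\rangle$ and $\Psi^0(\sigma)=\sup_{\Psi(\eta)=1}\langle\sigma,\eta\rangle$. The anisotropic Minkowski gauge on $\mathbb{R}^N=\mathbb{R}^m\times\mathbb{R}^k$ is $$\Theta(z,\sigma)=\left(\Phi(z)^{2(\alpha+1)}+4(\alpha+1)^2\Psi(\sigma)^2\right)^{\frac{1}{2(\alpha+1)}}.$$ *)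

theory Defs
  imports "HOL-Analysis.Analysis"
begin

text \<open>
  Intended for open \<open>S\<close>: \<open>D x\<close> and \<open>H x\<close> are the first and second Frechet derivatives at \<open>x\<close>.
  Continuity of \<open>f\<close> and \<open>D\<close> follows from their differentiability.
\<close>
definition C2_on :: "'a::real_normed_vector set \<Rightarrow> ('a \<Rightarrow> real) \<Rightarrow> bool" where
  "C2_on S f \<longleftrightarrow>
    (\<exists>(D :: 'a \<Rightarrow> 'a \<Rightarrow>\<^sub>L real) (H :: 'a \<Rightarrow> 'a \<Rightarrow>\<^sub>L 'a \<Rightarrow>\<^sub>L real).
      (\<forall>x\<in>S. (f has_derivative blinfun_apply (D x)) (at x)) \<and>
      (\<forall>x\<in>S. (D has_derivative blinfun_apply (H x)) (at x)) \<and>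
      continuous_on S H)"

definition strictly_convex_on :: "'a::real_vector set \<Rightarrow> ('a \<Rightarrow> real) \<Rightarrow> bool" where
  "strictly_convex_on S f \<longleftrightarrow> convex S \<and>
    (\<forall>x\<in>S. \<forall>y\<in>S. \<forall>t. x \<noteq> y \<longrightarrow> 0 < t \<longrightarrow> t < 1 \<longrightarrow>
      f ((1 - t) *\<^sub>R x + t *\<^sub>R y) < (1 - t) * f x + t * f y)"

text \<open>
  Smoothness is required only away from the origin, strict convexity of the square on the
  whole (convex) space.
\<close>
definition minkowski_norm :: "('a::euclidean_space \<Rightarrow> real) \<Rightarrow> bool" where
  "minkowski_norm N \<longleftrightarrow>
    (\<forall>x. 0 \<le> N x) \<and>
    C2_on (UNIV - {0}) (\<lambda>x. (N x)\<^sup>2) \<and>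
    strictly_convex_on UNIV (\<lambda>x. (N x)\<^sup>2) \<and>
    (\<forall>x c. N (c *\<^sub>R x) = \<bar>c\<bar> * N x)"

definition dual_norm :: "('a::euclidean_space \<Rightarrow> real) \<Rightarrow> 'a \<Rightarrow> real" where
  "dual_norm N z = (SUP \<zeta>\<in>{\<zeta>. N \<zeta> = 1}. z \<bullet> \<zeta>)"

definition aniso_gauge ::
  "real \<Rightarrow> ('a::euclidean_space \<Rightarrow> real) \<Rightarrow> ('b::euclidean_space \<Rightarrow> real) \<Rightarrow> 'a \<times> 'b \<Rightarrow> real" where
  "aniso_gauge \<alpha> \<Phi> \<Psi> = (\<lambda>(z, \<sigma>).
    (\<Phi> z powr (2 * (\<alpha> + 1)) + 4 * (\<alpha> + 1)\<^sup>2 * (\<Psi> \<sigma>)\<^sup>2) powr (1 / (2 * (\<alpha> + 1))))"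

text \<open>
  The extremum problem prescribes the power \<open>\<alpha> + 1\<close> of the value; the value itself is the
  nonnegative real with that power.  For gauges built from Minkowski norms the constraint set is
  nonempty and compact, so the supremum is an actual least upper bound of real numbers.
\<close>
definition aniso_legendre ::
  "real \<Rightarrow> ('a::euclidean_space \<times> 'b::euclidean_space \<Rightarrow> real) \<Rightarrow> 'a \<times> 'b \<Rightarrow> real" where
  "aniso_legendre \<alpha> \<Theta> = (\<lambda>(z, \<sigma>).
    THE t. 0 \<le> t \<and>
      t powr (\<alpha> + 1) =
        (SUP (\<xi>, \<tau>)\<in>{(\<xi>, \<tau>). \<Theta> (\<xi>, \<tau>) = 1}.
          \<bar>z \<bullet> \<xi>\<bar> powr (\<alpha> + 1) + 4 * (\<alpha> + 1)\<^sup>2 * (\<sigma> \<bullet> \<tau>)))"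

end

theory Submission
  imports Defs
begin

text \<open>
  Write \<open>p = \<alpha> + 1\<close>, \<open>A = \<Phi>\<^sup>0(z)\<^sup>p\<close> and \<open>B = 2 p \<Psi>\<^sup>0(\<sigma>)\<close>.  In the quantities
  \<open>x = \<Phi>(\<xi>)\<^sup>p\<close> and \<open>y = 2 p \<Psi>(\<tau>)\<close> the constraint \<open>\<Theta>(\<xi>, \<tau>) = 1\<close> is the circle equation
  \<open>x\<^sup>2 + y\<^sup>2 = 1\<close>, and the duality inequalities \<open>\<bar>\<langle>z, \<xi>\<rangle>\<bar> \<le> \<Phi>\<^sup>0(z) \<Phi>(\<xi>)\<close> and
  \<open>\<langle>\<sigma>, \<tau>\<rangle> \<le> \<Psi>\<^sup>0(\<sigma>) \<Psi>(\<tau>)\<close> bound the objective by \<open>A x + B y\<close>.  The problem thus reduces to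
  maximizing a linear form with nonnegative coefficients on the unit circle of the plane: by
  Cauchy-Schwarz the maximum is \<open>sqrt (A\<^sup>2 + B\<^sup>2)\<close>, reached in the closed first quadrant.

  The bound is sharp because the duality inequalities are: the unit sphere of a Minkowski norm is
  compact (\<open>minkowski_norm_compact_unit_sphere\<close>), so the suprema defining \<open>\<Phi>\<^sup>0(z)\<close> and \<open>\<Psi>\<^sup>0(\<sigma>)\<close> are
  attained (\<open>dual_norm_attained\<close>).  Rescaling the two maximizers so that \<open>(x, y)\<close> is the maximizer
  on the circle produces a maximizer of the original problem.
\<close>

lemma minkowski_norm_scaleR:
  assumes "minkowski_norm N"
  shows "N (c *\<^sub>R x) = \<bar>c\<bar> * N x"
  using assms unfolding minkowski_norm_def by blast

lemma minkowski_norm_nonneg: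
  assumes "minkowski_norm N"
  shows "0 \<le> N x"
  using assms unfolding minkowski_norm_def by blast

lemma minkowski_norm_zero:
  assumes "minkowski_norm N"
  shows "N 0 = 0"
  using minkowski_norm_scaleR[OF assms, of 0 0] by simp

text \<open>
  Definiteness comes from strict convexity: \<open>0\<close> is the midpoint of \<open>x\<close> and \<open>- x\<close>, where the square
  of the norm takes the same value.
\<close>

lemma minkowski_norm_pos:
  assumes N: "minkowski_norm N" and "x \<noteq> 0"
  shows "0 < N x"
proof -
  have ne: "x \<noteq> - x"
  proof
    assume "x = - x"
    then have "2 *\<^sub>R x = 0" by (metis add.right_inverse scaleR_2)
    with \<open>x \<noteq> 0\<close> show False by simp
  qed
  have "\<forall>x y t. x \<noteq> y \<longrightarrow> 0 < t \<longrightarrow> t < 1 \<longrightarrow>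
      (N ((1 - t) *\<^sub>R x + t *\<^sub>R y))\<^sup>2 < (1 - t) * (N x)\<^sup>2 + t * (N y)\<^sup>2"
    using N unfolding minkowski_norm_def strictly_convex_on_def by blast
  from this[rule_format, OF ne, of "1/2"] have "(N ((1 - 1/2) *\<^sub>R x + (1/2) *\<^sub>R (- x)))\<^sup>2 < (1 - 1/2) * (N x)\<^sup>2 + (1/2) * (N (- x))\<^sup>2"
    by simp
  moreover have "(1 - 1/2) *\<^sub>R x + (1/2) *\<^sub>R (- x) = 0" by simp
  moreover have "N (- x) = N x"
    using minkowski_norm_scaleR[OF N, of "-1" x] by simp
  ultimately have "0 < (N x)\<^sup>2"
    using minkowski_norm_zero[OF N] by simp
  then show ?thesis
    using minkowski_norm_nonneg[OF N, of x] by (simp add: less_le)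
qed

lemma minkowski_norm_continuous_on:
  assumes N: "minkowski_norm N"
  shows "continuous_on (UNIV - {0}) N"
proof -
  obtain D where D: "\<forall>x\<in>UNIV - {0}. ((\<lambda>x. (N x)\<^sup>2) has_derivative blinfun_apply (D x)) (at x)"
    using N unfolding minkowski_norm_def C2_on_def by blast
  have "continuous_on (UNIV - {0}) (\<lambda>x. (N x)\<^sup>2)"
    using D by (auto intro!: continuous_at_imp_continuous_on dest: has_derivative_continuous)
  then have "continuous_on (UNIV - {0}) (\<lambda>x. sqrt ((N x)\<^sup>2))"
    by (rule continuous_on_real_sqrt)
  then show ?thesis
    using minkowski_norm_nonneg[OF N] by simp
qed

text \<open>
  Radial projection maps the Euclidean unit sphere continuously onto the unit sphere of the norm.
\<close>

lemma minkowski_norm_compact_unit_sphere: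
  fixes N :: "'a::euclidean_space \<Rightarrow> real"
  assumes N: "minkowski_norm N"
  shows "compact {\<zeta>. N \<zeta> = 1}" and "{\<zeta>. N \<zeta> = 1} \<noteq> {}"
proof -
  let ?g = "\<lambda>x. (1 / N x) *\<^sub>R x"
  have pos: "0 < N x" if "x \<in> sphere 0 1" for x
    using that by (intro minkowski_norm_pos[OF N]) auto
  have eq: "{\<zeta>. N \<zeta> = 1} = ?g ` sphere 0 1"
  proof (intro equalityI subsetI)
    fix x assume "x \<in> {\<zeta>. N \<zeta> = 1}"
    then have x: "N x = 1" by simp
    then have "x \<noteq> 0" using minkowski_norm_zero[OF N] by auto
    then have "x = ?g ((1 / norm x) *\<^sub>R x)"
      using x by (simp add: minkowski_norm_scaleR[OF N])
    moreover have "(1 / norm x) *\<^sub>R x \<in> sphere 0 1"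
      using \<open>x \<noteq> 0\<close> by simp
    ultimately show "x \<in> ?g ` sphere 0 1" by blast
  next
    fix y assume "y \<in> ?g ` sphere 0 1"
    then obtain x where "x \<in> sphere 0 1" "y = ?g x" by blast
    then show "y \<in> {\<zeta>. N \<zeta> = 1}"
      using pos[of x] by (simp add: minkowski_norm_scaleR[OF N])
  qed
  have "continuous_on (sphere 0 1) N"
    by (rule continuous_on_subset[OF minkowski_norm_continuous_on[OF N]]) auto
  then have "continuous_on (sphere 0 1) ?g"
    using pos by (intro continuous_intros) (auto simp: less_le)
  then show "compact {\<zeta>. N \<zeta> = 1}"
    unfolding eq by (intro compact_continuous_image) auto
  show "{\<zeta>. N \<zeta> = 1} \<noteq> {}"
    unfolding eq by simp
qed

lemma dual_norm_attained:
  fixes N :: "'a::euclidean_space \<Rightarrow> real"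
  assumes N: "minkowski_norm N"
  obtains \<zeta> where "N \<zeta> = 1" "z \<bullet> \<zeta> = dual_norm N z" "\<And>\<xi>. N \<xi> = 1 \<Longrightarrow> z \<bullet> \<xi> \<le> dual_norm N z"
proof -
  have "continuous_on {\<zeta>. N \<zeta> = 1} (\<lambda>\<zeta>. z \<bullet> \<zeta>)"
    by (intro continuous_intros)
  then obtain \<zeta> where \<zeta>: "N \<zeta> = 1" "\<And>\<xi>. N \<xi> = 1 \<Longrightarrow> z \<bullet> \<xi> \<le> z \<bullet> \<zeta>"
    using continuous_attains_sup[OF minkowski_norm_compact_unit_sphere[OF N]] by blast
  have "dual_norm N z = z \<bullet> \<zeta>"
    unfolding dual_norm_def using \<zeta> by (intro cSup_eq_maximum) auto
  with \<zeta> that show thesis by simp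
qed

lemma abs_inner_le_dual_norm:
  fixes N :: "'a::euclidean_space \<Rightarrow> real"
  assumes N: "minkowski_norm N"
  shows "\<bar>z \<bullet> \<xi>\<bar> \<le> dual_norm N z * N \<xi>"
proof (cases "\<xi> = 0")
  case True
  then show ?thesis by (simp add: minkowski_norm_zero[OF N])
next
  case False
  then have pos: "0 < N \<xi>" by (rule minkowski_norm_pos[OF N])
  have "c * (z \<bullet> \<xi>) \<le> dual_norm N z * N \<xi>" if "\<bar>c\<bar> = 1" for c :: real
  proof -
    have "N ((c / N \<xi>) *\<^sub>R \<xi>) = 1"
      using pos that by (simp add: minkowski_norm_scaleR[OF N])
    then have "z \<bullet> ((c / N \<xi>) *\<^sub>R \<xi>) \<le> dual_norm N z"
      using dual_norm_attained[OF N, of z] by metis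
    then show ?thesis
      using pos by (simp add: field_simps)
  qed
  from this[of 1] this[of "-1"] show ?thesis by simp
qed

lemma dual_norm_nonneg:
  fixes N :: "'a::euclidean_space \<Rightarrow> real"
  assumes N: "minkowski_norm N"
  shows "0 \<le> dual_norm N z"
proof -
  obtain \<zeta> where "N \<zeta> = 1" using minkowski_norm_compact_unit_sphere(2)[OF N] by blast
  then have "\<bar>z \<bullet> \<zeta>\<bar> \<le> dual_norm N z"
    using abs_inner_le_dual_norm[OF N, of z \<zeta>] by simp
  then show ?thesis by linarith
qed

lemma linear_form_le_on_unit_circle:
  fixes A B x y :: real
  assumes "x\<^sup>2 + y\<^sup>2 = 1"
  shows "A * x + B * y \<le> sqrt (A\<^sup>2 + B\<^sup>2)"
proof (rule real_le_rsqrt)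
  \<comment> \<open>The added square is the defect in Lagrange's identity.\<close>
  have "(A * x + B * y)\<^sup>2 \<le> (A * x + B * y)\<^sup>2 + (A * y - B * x)\<^sup>2" by simp
  also have "\<dots> = (A\<^sup>2 + B\<^sup>2) * (x\<^sup>2 + y\<^sup>2)"
    by (simp add: power2_eq_square algebra_simps)
  finally show "(A * x + B * y)\<^sup>2 \<le> A\<^sup>2 + B\<^sup>2" using assms by simp
qed

lemma linear_form_attained_on_unit_circle:
  fixes A B :: real
  assumes "0 \<le> A" "0 \<le> B"
  obtains x y where "0 \<le> x" "0 \<le> y" "x\<^sup>2 + y\<^sup>2 = 1" "A * x + B * y = sqrt (A\<^sup>2 + B\<^sup>2)"
proof (cases "A = 0 \<and> B = 0")
  case True
  then show ?thesis using that[of 1 0] by simp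
next
  case False
  let ?S = "sqrt (A\<^sup>2 + B\<^sup>2)"
  have S: "0 < ?S" "?S\<^sup>2 = A\<^sup>2 + B\<^sup>2" using False by (simp_all add: sum_power2_gt_zero_iff)
  show ?thesis
  proof (rule that[of "A / ?S" "B / ?S"])
    have "(A / ?S)\<^sup>2 + (B / ?S)\<^sup>2 = (A\<^sup>2 + B\<^sup>2) / ?S\<^sup>2"
      by (simp only: power_divide add_divide_distrib)
    also have "\<dots> = 1"
      unfolding S(2) using False by (simp add: sum_power2_eq_zero_iff)
    finally show "(A / ?S)\<^sup>2 + (B / ?S)\<^sup>2 = 1" .
    have "A * (A / ?S) + B * (B / ?S) = (A\<^sup>2 + B\<^sup>2) / ?S"
      by (simp add: add_divide_distrib power2_eq_square)
    then show "A * (A / ?S) + B * (B / ?S) = ?S"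
      by (simp add: real_div_sqrt)
  qed (use assms S in auto)
qed

lemma powr_inject_nonneg:
  fixes s t p :: real
  assumes "0 \<le> s" "0 \<le> t" "p \<noteq> 0" and eq: "s powr p = t powr p"
  shows "s = t"
proof -
  have "(s powr p) powr (1 / p) = (t powr p) powr (1 / p)"
    by (simp only: eq)
  then show ?thesis
    using assms(1-3) by (simp add: powr_powr)
qed

lemma powr_plus_square_eq_sum_squares:
  fixes u v p :: real
  shows "u powr (2 * p) + 4 * p\<^sup>2 * v\<^sup>2 = (u powr p)\<^sup>2 + (2 * p * v)\<^sup>2"
proof -
  have "u powr (2 * p) = (u powr p)\<^sup>2"
    by (simp only: mult_2 powr_add power2_eq_square)
  then show ?thesis by (simp add: power_mult_distrib)
qed

lemma aniso_gauge_eq_1_iff: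
  assumes "0 < \<alpha>"
  shows "aniso_gauge \<alpha> \<Phi> \<Psi> (\<xi>, \<tau>) = 1 \<longleftrightarrow>
    (\<Phi> \<xi> powr (\<alpha> + 1))\<^sup>2 + (2 * (\<alpha> + 1) * \<Psi> \<tau>)\<^sup>2 = 1"
proof -
  let ?b = "\<Phi> \<xi> powr (2 * (\<alpha> + 1)) + 4 * (\<alpha> + 1)\<^sup>2 * (\<Psi> \<tau>)\<^sup>2"
  have b: "?b = (\<Phi> \<xi> powr (\<alpha> + 1))\<^sup>2 + (2 * (\<alpha> + 1) * \<Psi> \<tau>)\<^sup>2"
    by (rule powr_plus_square_eq_sum_squares)
  have "0 \<le> ?b" by simp
  then have "?b powr (1 / (2 * (\<alpha> + 1))) = 1 powr (1 / (2 * (\<alpha> + 1))) \<longleftrightarrow> ?b = 1"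
    using assms by (intro iffI powr_inject_nonneg[of ?b 1 "1 / (2 * (\<alpha> + 1))"]) simp_all
  then show ?thesis unfolding aniso_gauge_def prod.case b powr_one_eq_one .
qed

text \<open>
  Every feasible point yields a point of the unit circle at which the linear form dominates the
  objective; conversely the maximizer on the circle lifts to a feasible point where both values
  agree.  The supremum is therefore a maximum.
\<close>

lemma aniso_extremum_value:
  fixes \<Phi> :: "'a::euclidean_space \<Rightarrow> real" and \<Psi> :: "'b::euclidean_space \<Rightarrow> real"
  assumes \<Phi>: "minkowski_norm \<Phi>" and \<Psi>: "minkowski_norm \<Psi>" and \<alpha>: "0 < \<alpha>"
  shows "(SUP (\<xi>, \<tau>)\<in>{(\<xi>, \<tau>). aniso_gauge \<alpha> \<Phi> \<Psi> (\<xi>, \<tau>) = 1}.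
      \<bar>z \<bullet> \<xi>\<bar> powr (\<alpha> + 1) + 4 * (\<alpha> + 1)\<^sup>2 * (\<sigma> \<bullet> \<tau>)) =
    sqrt ((dual_norm \<Phi> z powr (\<alpha> + 1))\<^sup>2 + (2 * (\<alpha> + 1) * dual_norm \<Psi> \<sigma>)\<^sup>2)"
    (is "(SUP (\<xi>, \<tau>)\<in>?C. ?f \<xi> \<tau>) = sqrt (?A\<^sup>2 + ?B\<^sup>2)")
proof (rule cSup_eq_maximum)
  obtain \<zeta> where \<zeta>: "\<Phi> \<zeta> = 1" "z \<bullet> \<zeta> = dual_norm \<Phi> z"
    using dual_norm_attained[OF \<Phi>] by metis
  obtain \<eta> where \<eta>: "\<Psi> \<eta> = 1" "\<sigma> \<bullet> \<eta> = dual_norm \<Psi> \<sigma>"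
    using dual_norm_attained[OF \<Psi>] by metis
  have nonneg: "0 \<le> ?A" "0 \<le> ?B" "0 \<le> dual_norm \<Phi> z"
    using \<alpha> dual_norm_nonneg[OF \<Phi>] dual_norm_nonneg[OF \<Psi>] by auto
  obtain x y where xy: "0 \<le> x" "0 \<le> y" "x\<^sup>2 + y\<^sup>2 = 1" "?A * x + ?B * y = sqrt (?A\<^sup>2 + ?B\<^sup>2)"
    using linear_form_attained_on_unit_circle[OF nonneg(1,2)] by blast
  \<comment> \<open>The scaling makes \<open>\<Phi>(\<xi>)\<^sup>p = x\<close> and \<open>2 p \<Psi>(\<tau>) = y\<close>.\<close>
  define \<xi> where "\<xi> = (x powr (1 / (\<alpha> + 1))) *\<^sub>R \<zeta>"
  define \<tau> where "\<tau> = (y / (2 * (\<alpha> + 1))) *\<^sub>R \<eta>"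
  have root: "(x powr (1 / (\<alpha> + 1))) powr (\<alpha> + 1) = x"
    using \<alpha> xy(1) by (simp add: powr_powr)
  have "\<Phi> \<xi> powr (\<alpha> + 1) = x"
    unfolding \<xi>_def by (simp add: minkowski_norm_scaleR[OF \<Phi>] \<zeta> root)
  moreover have "2 * (\<alpha> + 1) * \<Psi> \<tau> = y"
    unfolding \<tau>_def using \<alpha> xy(2) by (simp add: minkowski_norm_scaleR[OF \<Psi>] \<eta>)
  ultimately have "(\<xi>, \<tau>) \<in> ?C"
    using xy(3) by (simp add: aniso_gauge_eq_1_iff[OF \<alpha>])
  moreover have "?f \<xi> \<tau> = sqrt (?A\<^sup>2 + ?B\<^sup>2)"
  proof -
    have "\<bar>z \<bullet> \<xi>\<bar> powr (\<alpha> + 1) = ?A * x"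
      unfolding \<xi>_def using nonneg(3) by (simp add: \<zeta> abs_mult powr_mult root)
    moreover have "4 * (\<alpha> + 1)\<^sup>2 * (\<sigma> \<bullet> \<tau>) = ?B * y"
      unfolding \<tau>_def using \<alpha> by (simp add: \<eta> power2_eq_square field_simps)
    ultimately show ?thesis using xy(4) by simp
  qed
  ultimately show "sqrt (?A\<^sup>2 + ?B\<^sup>2) \<in> (\<lambda>(\<xi>, \<tau>). ?f \<xi> \<tau>) ` ?C"
    by force
next
  fix v assume "v \<in> (\<lambda>(\<xi>, \<tau>). ?f \<xi> \<tau>) ` ?C"
  then obtain \<xi> \<tau> where C: "aniso_gauge \<alpha> \<Phi> \<Psi> (\<xi>, \<tau>) = 1" and v: "v = ?f \<xi> \<tau>"
    by auto
  have "\<bar>z \<bullet> \<xi>\<bar> powr (\<alpha> + 1) \<le> (dual_norm \<Phi> z * \<Phi> \<xi>) powr (\<alpha> + 1)"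
    using \<alpha> abs_inner_le_dual_norm[OF \<Phi>] by (intro powr_mono2) auto
  also have "\<dots> = ?A * \<Phi> \<xi> powr (\<alpha> + 1)"
    using dual_norm_nonneg[OF \<Phi>] minkowski_norm_nonneg[OF \<Phi>] by (simp add: powr_mult)
  finally have 1: "\<bar>z \<bullet> \<xi>\<bar> powr (\<alpha> + 1) \<le> ?A * \<Phi> \<xi> powr (\<alpha> + 1)" .
  have "\<sigma> \<bullet> \<tau> \<le> dual_norm \<Psi> \<sigma> * \<Psi> \<tau>"
    using abs_inner_le_dual_norm[OF \<Psi>, of \<sigma> \<tau>] by linarith
  then have "4 * (\<alpha> + 1)\<^sup>2 * (\<sigma> \<bullet> \<tau>) \<le> 4 * (\<alpha> + 1)\<^sup>2 * (dual_norm \<Psi> \<sigma> * \<Psi> \<tau>)"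
    by (intro mult_left_mono) auto
  also have "\<dots> = ?B * (2 * (\<alpha> + 1) * \<Psi> \<tau>)"
    by (simp add: power2_eq_square algebra_simps)
  finally have "v \<le> ?A * \<Phi> \<xi> powr (\<alpha> + 1) + ?B * (2 * (\<alpha> + 1) * \<Psi> \<tau>)"
    using 1 v by simp
  also have "\<dots> \<le> sqrt (?A\<^sup>2 + ?B\<^sup>2)"
    using C by (intro linear_form_le_on_unit_circle) (simp add: aniso_gauge_eq_1_iff[OF \<alpha>])
  finally show "v \<le> sqrt (?A\<^sup>2 + ?B\<^sup>2)" .
qed

theorem proposition3p3:
  fixes \<Phi> :: "real ^ 'm \<Rightarrow> real"
    and \<Psi> :: "real ^ 'k \<Rightarrow> real"
    and \<alpha> :: real
    and z :: "real ^ 'm"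
    and \<sigma> :: "real ^ 'k"
  assumes "minkowski_norm \<Phi>"
    and "minkowski_norm \<Psi>"
    and "\<alpha> > 0"
  shows "aniso_legendre \<alpha> (aniso_gauge \<alpha> \<Phi> \<Psi>) (z, \<sigma>) =
    (dual_norm \<Phi> z powr (2 * (\<alpha> + 1)) + 4 * (\<alpha> + 1)\<^sup>2 * (dual_norm \<Psi> \<sigma>)\<^sup>2)
      powr (1 / (2 * (\<alpha> + 1)))"
proof -
  let ?Q = "dual_norm \<Phi> z powr (2 * (\<alpha> + 1)) + 4 * (\<alpha> + 1)\<^sup>2 * (dual_norm \<Psi> \<sigma>)\<^sup>2"
  have Q: "?Q = (dual_norm \<Phi> z powr (\<alpha> + 1))\<^sup>2 + (2 * (\<alpha> + 1) * dual_norm \<Psi> \<sigma>)\<^sup>2"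
    by (rule powr_plus_square_eq_sum_squares)
  have Q_nonneg: "0 \<le> ?Q" by simp
  have root: "(?Q powr (1 / (2 * (\<alpha> + 1)))) powr (\<alpha> + 1) = sqrt ?Q"
  proof -
    have "1 / (2 * (\<alpha> + 1)) * (\<alpha> + 1) = 1 / 2" using assms(3) by (simp add: field_simps)
    then show ?thesis using Q_nonneg by (simp only: powr_powr powr_half_sqrt)
  qed
  show ?thesis
    unfolding aniso_legendre_def prod.case aniso_extremum_value[OF assms] Q[symmetric]
  proof (rule the_equality)
    fix t assume t: "0 \<le> t \<and> t powr (\<alpha> + 1) = sqrt ?Q"
    show "t = ?Q powr (1 / (2 * (\<alpha> + 1)))"
    proof (rule powr_inject_nonneg)
      show "t powr (\<alpha> + 1) = (?Q powr (1 / (2 * (\<alpha> + 1)))) powr (\<alpha> + 1)"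
        unfolding root using t by blast
    qed (use t assms(3) in simp_all)
  next
    show "0 \<le> ?Q powr (1 / (2 * (\<alpha> + 1))) \<and>
        (?Q powr (1 / (2 * (\<alpha> + 1)))) powr (\<alpha> + 1) = sqrt ?Q"
      unfolding root by simp
  qed
qed

end
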